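(* Let $\{G_n\}_{n \geq 1}$ be a family of graphs such that $\sup_{n \geq 1} \Delta(G_n) = \infty$. Let $I := [0,R)$ for some $0 < R \leq \infty$ and let $f: I \rightarrow \mathbb{R}$ be a function such that for every $n \geq 1$, $\beta^T f_{G_n}[M] \beta \geq 0$ for every symmetric matrix $M \in \mathbb{S}_{G_n}(I)$ and every $\beta \in \mathbb{R}^{|G_n|}$ such that $\beta^T M \beta \geq 0$. Then $f$ is analytic and absolutely monotonic on $I$.
   Context: All graphs $G=(V,E)$ are finite, undirected, with no self-loops, with vertex set $V=\{1,\dots,n\}$ and $|G|:=|V|$; $\Delta(G)$ denotes the maximum degree of the vertices of $G$. For $I \subset \mathbb{R}$, $\mathbb{S}_n(I)$ is the set of real symmetric $n\times n$ matrices with entries in $I$, and $\mathbb{S}_G(I) := \{A \in \mathbb{S}_{|G|}(I) : a_{ij} = 0 \text{ for every } (i,j)\notin E,\ i\neq j\}$. For a function $f: I \to \mathbb{R}$ and $A\in \mathbb{S}_{|G|}(I)$, $f_G[A]$ is the matrix with $(i,j)$ entry $f(a_{ij})$ if $(i,j)\in E$ or $i=j$, and $0$ otherwise. A continuous function $f$ on an interval $I$ with interior $I^\circ$ is absolutely monotonic on $I$ if it is $C^\infty$ on $I^\circ$ and $f^{(k)}(x)\ge 0$ for every $x\in I^\circ$ and every $k\ge 0$. *)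

theory Defs
  imports
    "HOL-Analysis.Analysis"
    "HOL-Library.Extended_Nat"
    "HOL-Library.Extended_Real"
    "Graph_Theory.Graph_Theory"
    "Jordan_Normal_Form.Matrix"
begin

definition graph_order :: "nat pair_pre_digraph \<Rightarrow> nat" where
  "graph_order G = card (pverts G)"

text \<open>
  An undirected loopless graph is a \<^locale>\<open>pair_graph\<close>: its arc relation is finite, irreflexive
  and symmetric, and an edge is represented by its two orientations. The vertices are
  \<open>0, \<dots>, n - 1\<close> rather than \<open>1, \<dots>, n\<close>, so that they are the row and column indices of an
  \<open>n \<times> n\<close> matrix.
\<close>

definition labelled_graph :: "nat pair_pre_digraph \<Rightarrow> bool" where
  "labelled_graph G \<longleftrightarrow> pair_graph G \<and> pverts G = {0..<graph_order G}"

text \<open>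
  As each edge contributes one arc leaving each of its ends, the out-degree is the degree.
  The element \<open>0\<close> only matters for the graph without vertices.
\<close>

definition max_degree :: "nat pair_pre_digraph \<Rightarrow> nat" where
  "max_degree G = Max (insert 0 (out_degree (with_proj G) ` pverts G))"

definition sym_mats :: "nat \<Rightarrow> real set \<Rightarrow> real mat set" where
  "sym_mats n I =
     {A \<in> carrier_mat n n. transpose_mat A = A \<and> (\<forall>i<n. \<forall>j<n. A $$ (i, j) \<in> I)}"

definition graph_sym_mats :: "nat pair_pre_digraph \<Rightarrow> real set \<Rightarrow> real mat set" where
  "graph_sym_mats G I =
     {A \<in> sym_mats (graph_order G) I.
        \<forall>i<graph_order G. \<forall>j<graph_order G. (i, j) \<notin> parcs G \<and> i \<noteq> j \<longrightarrow> A $$ (i, j) = 0}"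

definition graph_entrywise ::
    "(real \<Rightarrow> real) \<Rightarrow> nat pair_pre_digraph \<Rightarrow> real mat \<Rightarrow> real mat" where
  "graph_entrywise f G A =
     Matrix.mat (graph_order G) (graph_order G)
       (\<lambda>(i, j). if (i, j) \<in> parcs G \<or> i = j then f (A $$ (i, j)) else 0)"

definition quad_form :: "real mat \<Rightarrow> real vec \<Rightarrow> real" where
  "quad_form A \<beta> = scalar_prod \<beta> (mult_mat_vec A \<beta>)"

text \<open>
  The derivatives are taken at interior points only, so they do not depend on the values of the
  total function \<open>f\<close> outside \<open>I\<close>.
\<close>

definition absolutely_monotonic_on :: "(real \<Rightarrow> real) \<Rightarrow> real set \<Rightarrow> bool" where
  "absolutely_monotonic_on f I \<longleftrightarrow>
     continuous_on I f \<and>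
     (\<forall>k. \<forall>x \<in> interior I. (deriv ^^ k) f differentiable at x) \<and>
     (\<forall>k. \<forall>x \<in> interior I. 0 \<le> (deriv ^^ k) f x)"

text \<open>
  Near every point of \<open>I\<close>, endpoints belonging to \<open>I\<close> included, the restriction of \<open>f\<close> to \<open>I\<close> is the
  sum of a convergent power series. Values of \<open>f\<close> outside \<open>I\<close> are not constrained.
\<close>

definition real_analytic_on :: "(real \<Rightarrow> real) \<Rightarrow> real set \<Rightarrow> bool" where
  "real_analytic_on f I \<longleftrightarrow>
     (\<forall>x \<in> I. \<exists>r > 0. \<exists>a :: nat \<Rightarrow> real.
        \<forall>y \<in> I. \<bar>y - x\<bar> < r \<longrightarrow> (\<lambda>k. a k * (y - x) ^ k) sums f y)"

end

theory Submission
  imports Defs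
begin

text \<open>
  The hypothesis concerns every symmetric \<open>M\<close> with entries in \<open>I\<close>, not only the positive
  semidefinite ones, and this leaves so few functions that \<open>f\<close> can be determined outright: it is
  affine, \<open>f x = f 0 + d * x\<close> with \<open>f 0 \<ge> 0\<close> and \<open>d \<ge> 0\<close>.

  Some graph of the family has a vertex \<open>u\<close> with two neighbours \<open>v\<close> and \<open>w\<close>. Let the only nonzero
  entries of \<open>M\<close> be \<open>a\<close> at \<open>(u, u)\<close> and \<open>b\<close> at \<open>(u, v)\<close> and \<open>(v, u)\<close>, and let \<open>\<beta>\<close> be \<open>1\<close>, \<open>-t\<close>,
  \<open>t - 1\<close> at \<open>u\<close>, \<open>v\<close>, \<open>w\<close> and zero elsewhere. Then \<open>\<beta>\<^sup>T M \<beta> = a - 2 t b\<close> vanishes for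
  \<open>a = 2 t b\<close>. If \<open>v\<close> and \<open>w\<close> are adjacent, the constant part \<open>f 0\<close> of \<open>f\<close> does not contribute to
  the form of the image matrix, since the coordinates of \<open>\<beta>\<close> add up to zero; if they are not
  adjacent, \<open>f 0 = 0\<close>, because testing the zero matrix against \<open>(1, 0, 0)\<close> and \<open>(-1, 1, 1)\<close>
  gives \<open>f 0 \<ge> 0\<close> and \<open>f 0 \<le> 0\<close>. In both cases \<open>g x = f x - f 0\<close> satisfies
  \<open>g (2 t b) \<ge> 2 t g b\<close> whenever \<open>t \<ge> 0\<close> and both points lie in \<open>I\<close>
  (\<open>increment_superhomogeneous\<close>). Exchanging the two points turns the inequality into an equality
  (\<open>increment_proportional\<close>), so \<open>g\<close> is linear on \<open>I\<close>. Its slope is nonnegative because \<open>t = 0\<close>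
  may be combined with any \<open>a \<ge> 0\<close>. For an affine function with nonnegative coefficients both
  conclusions are immediate.
\<close>

lemma max_degree_ge_2_cherry:
  assumes G: "labelled_graph G" and deg: "max_degree G \<ge> 2"
  obtains u v w where "(u, v) \<in> parcs G" "(u, w) \<in> parcs G" "v \<noteq> w"
proof -
  interpret pair_graph G using G by (simp add: labelled_graph_def)
  have "max_degree G \<in> insert 0 (out_degree (with_proj G) ` pverts G)"
    unfolding max_degree_def by (rule Max_in) auto
  with deg obtain u where "out_degree (with_proj G) u \<ge> 2"
    by auto
  then have "card (out_arcs (with_proj G) u) \<ge> 2"
    by (simp add: out_degree_def)
  then obtain e e' where e: "e \<in> out_arcs (with_proj G) u" "e' \<in> out_arcs (with_proj G) u" "e \<noteq> e'"
    by (meson card_2_iff' obtain_subset_with_card_n subset_iff)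
  show thesis
    by (rule that[of u "snd e" "snd e'"]) (use e in \<open>cases e; cases e'; auto simp: out_arcs_def\<close>)+
qed

lemma quad_form_three_support:
  assumes A: "A \<in> carrier_mat n n" and lt: "u < n" "v < n" "w < n"
    and ne: "u \<noteq> v" "u \<noteq> w" "v \<noteq> w"
    and \<beta>: "\<beta> = Matrix.vec n (\<lambda>i. if i = u then x else if i = v then y else if i = w then z else 0)"
  shows "quad_form A \<beta> =
      x * (A $$ (u,u) * x + A $$ (u,v) * y + A $$ (u,w) * z)
    + y * (A $$ (v,u) * x + A $$ (v,v) * y + A $$ (v,w) * z)
    + z * (A $$ (w,u) * x + A $$ (w,v) * y + A $$ (w,w) * z)"
proof -
  have restrict: "(\<Sum>i\<in>{0..<n}. h i) = h u + h v + h w"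
    if "\<And>i. i \<notin> {u,v,w} \<Longrightarrow> h i = 0" for h :: "nat \<Rightarrow> real"
  proof -
    have "(\<Sum>i\<in>{0..<n}. h i) = (\<Sum>i\<in>{u,v,w}. h i)"
      by (rule sum.mono_neutral_right) (use lt that in auto)
    then show ?thesis using ne by (simp add: add.assoc)
  qed
  have row: "(A *\<^sub>v \<beta>) $ i = A $$ (i,u) * x + A $$ (i,v) * y + A $$ (i,w) * z" if "i < n" for i
  proof -
    have "(A *\<^sub>v \<beta>) $ i = (\<Sum>j\<in>{0..<n}. A $$ (i,j) *
            (if j = u then x else if j = v then y else if j = w then z else 0))"
      using A that by (auto simp: \<beta> scalar_prod_def intro!: sum.cong)
    then show ?thesis
      using ne by (subst (asm) restrict) auto
  qed
  have entry: "\<beta> $ i = (if i = u then x else if i = v then y else if i = w then z else 0)"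
    if "i < n" for i
    using that by (simp add: \<beta>)
  have "quad_form A \<beta> = (\<Sum>i\<in>{0..<n}.
          (if i = u then x else if i = v then y else if i = w then z else 0) *
          (A $$ (i,u) * x + A $$ (i,v) * y + A $$ (i,w) * z))"
    unfolding quad_form_def scalar_prod_def using A
    by (intro sum.cong) (auto simp: row entry simp del: index_mult_mat_vec)
  then show ?thesis
    using ne by (subst (asm) restrict) auto
qed

definition preserves_form_nonneg :: "nat pair_pre_digraph \<Rightarrow> (real \<Rightarrow> real) \<Rightarrow> real set \<Rightarrow> bool" where
  "preserves_form_nonneg G f I \<longleftrightarrow>
     (\<forall>M \<in> graph_sym_mats G I. \<forall>\<beta> \<in> carrier_vec (graph_order G).
        quad_form M \<beta> \<ge> 0 \<longrightarrow> quad_form (graph_entrywise f G M) \<beta> \<ge> 0)"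

text \<open>
  The hypothesis on \<open>f\<close> is only ever tested on this configuration: the entry \<open>a\<close> on the diagonal at
  the centre \<open>u\<close> of a cherry, the entry \<open>b\<close> on the edge \<open>uv\<close>, and a vector with coordinates \<open>x\<close>,
  \<open>y\<close>, \<open>z\<close> at \<open>u\<close>, \<open>v\<close>, \<open>w\<close>. The image of the zero entries is \<open>f 0\<close> on the diagonal and on the
  edges, hence the dependence on whether \<open>vw\<close> is an edge.
\<close>

lemma cherry_inequality:
  assumes G: "labelled_graph G" and pres: "preserves_form_nonneg G f I"
    and arcs: "(u, v) \<in> parcs G" "(u, w) \<in> parcs G" "v \<noteq> w"
    and I: "0 \<in> I" "a \<in> I" "b \<in> I"
    and form: "a * x\<^sup>2 + 2 * b * x * y \<ge> 0"
  shows "f a * x\<^sup>2 + 2 * f b * x * y + f 0 * (y\<^sup>2 + z\<^sup>2) + 2 * f 0 * x * z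
           + (if (v, w) \<in> parcs G then 2 * f 0 * y * z else 0) \<ge> 0"
proof -
  interpret pair_graph G using G by (simp add: labelled_graph_def)
  define n where "n = graph_order G"
  have verts: "pverts G = {0..<n}" using G by (simp add: labelled_graph_def n_def)
  have sym: "(j, i) \<in> parcs G" if "(i, j) \<in> parcs G" for i j
    using sym_arcs that by (auto simp: symmetric_def dest: symD)
  have lt: "u < n" "v < n" "w < n"
    using arcs wellformed(1,2) verts by fastforce+
  have ne: "u \<noteq> v" "u \<noteq> w"
    using arcs no_loops by fastforce+
  note ne = ne arcs(3)
  define M where "M = Matrix.mat n n (\<lambda>(i, j). if i = u \<and> j = u then a
     else if i = u \<and> j = v \<or> i = v \<and> j = u then b else 0)"
  define \<beta> where
    "\<beta> = Matrix.vec n (\<lambda>i. if i = u then x else if i = v then y else if i = w then z else 0)"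
  have M: "M \<in> graph_sym_mats G I"
    using I arcs sym
    by (auto simp: graph_sym_mats_def sym_mats_def M_def n_def[symmetric])
  have "quad_form M \<beta> = a * x\<^sup>2 + 2 * b * x * y"
    by (subst quad_form_three_support[OF _ lt ne \<beta>_def])
      (use lt ne in \<open>auto simp: M_def power2_eq_square algebra_simps\<close>)
  moreover have "\<beta> \<in> carrier_vec n" by (simp add: \<beta>_def)
  ultimately have "quad_form (graph_entrywise f G M) \<beta> \<ge> 0"
    using pres M form unfolding preserves_form_nonneg_def n_def by simp
  also have "quad_form (graph_entrywise f G M) \<beta> =
      f a * x\<^sup>2 + 2 * f b * x * y + f 0 * (y\<^sup>2 + z\<^sup>2) + 2 * f 0 * x * z
           + (if (v, w) \<in> parcs G then 2 * f 0 * y * z else 0)"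
    by (subst quad_form_three_support[OF _ lt ne \<beta>_def])
      (use lt ne arcs sym in \<open>auto simp: graph_entrywise_def n_def[symmetric] M_def
         power2_eq_square algebra_simps\<close>)
  finally show ?thesis .
qed

lemma nonneg_at_zero:
  assumes "labelled_graph G" "preserves_form_nonneg G f I"
    and "(u, v) \<in> parcs G" "(u, w) \<in> parcs G" "v \<noteq> w" and "0 \<in> I"
  shows "f 0 \<ge> 0"
  using cherry_inequality[OF assms assms(6) assms(6), of 1 0 0] by (simp split: if_splits)

text \<open>
  The coordinates \<open>1, -t, t - 1\<close> sum to zero, which removes \<open>f 0\<close> when \<open>u\<close>, \<open>v\<close>, \<open>w\<close> is a
  triangle. On an induced path \<open>v u w\<close>, where this cancellation breaks down, the matrix \<open>A + 1\<close> with
  \<open>A\<close> the adjacency matrix is not positive semidefinite, so its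
  multiple by \<open>f 0 \<ge> 0\<close>, the image of the zero matrix, can only pass the test if \<open>f 0 = 0\<close>.
\<close>

lemma increment_superhomogeneous:
  assumes G: "labelled_graph G" and pres: "preserves_form_nonneg G f I"
    and arcs: "(u, v) \<in> parcs G" "(u, w) \<in> parcs G" "v \<noteq> w"
    and I: "0 \<in> I" "a \<in> I" "b \<in> I" and a: "a \<ge> 2 * t * b"
  shows "f a - f 0 \<ge> 2 * t * (f b - f 0)"
proof -
  note cherry = cherry_inequality[OF G pres arcs I(1)]
  have *: "f a - 2 * t * f b + f 0 * (t\<^sup>2 + (t - 1)\<^sup>2) + 2 * f 0 * (t - 1)
         - (if (v, w) \<in> parcs G then 2 * f 0 * t * (t - 1) else 0) \<ge> 0"
    using cherry[OF I(2,3), of 1 "-t" "t - 1"] a by (simp add: algebra_simps split: if_splits)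
  show "f a - f 0 \<ge> 2 * t * (f b - f 0)"
  proof (cases "(v, w) \<in> parcs G")
    case True
    with * show ?thesis by (simp add: algebra_simps power2_eq_square)
  next
    case False
    with cherry[OF I(1) I(1), of "-1" 1 1] have "f 0 \<le> 0" by simp
    with nonneg_at_zero[OF G pres arcs I(1)] have "f 0 = 0" by simp
    with * False show ?thesis by simp
  qed
qed

lemma increment_proportional:
  assumes G: "labelled_graph G" and pres: "preserves_form_nonneg G f I"
    and arcs: "(u, v) \<in> parcs G" "(u, w) \<in> parcs G" "v \<noteq> w"
    and I: "0 \<in> I" "r \<in> I" "s \<in> I" and pos: "r > 0" "s > 0"
  shows "f s - f 0 = s / r * (f r - f 0)"
proof (rule antisym)
  note super = increment_superhomogeneous[OF G pres arcs I(1)]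
  show "f s - f 0 \<ge> s / r * (f r - f 0)"
    using super[OF I(3,2), of "s / r / 2"] pos by simp
  have "f r - f 0 \<ge> r / s * (f s - f 0)"
    using super[OF I(2,3), of "r / s / 2"] pos by simp
  then show "f s - f 0 \<le> s / r * (f r - f 0)"
    using pos by (simp add: field_simps)
qed

lemma affine_real_analytic_on:
  assumes f: "\<And>x. x \<in> I \<Longrightarrow> f x = c + d * x"
  shows "real_analytic_on f I"
  unfolding real_analytic_on_def
proof
  fix x assume x: "x \<in> I"
  define a where "a k = (if k = 0 then c + d * x else if k = 1 then d else 0)" for k :: nat
  have "(\<lambda>k. a k * (y - x) ^ k) sums f y" if "y \<in> I" for y
  proof -
    have "(\<lambda>k. a k * (y - x) ^ k) sums (\<Sum>k\<in>{0,1}. a k * (y - x) ^ k)"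
      by (rule sums_finite) (auto simp: a_def)
    also have "(\<Sum>k\<in>{0,1}. a k * (y - x) ^ k) = f y"
      using that by (simp add: a_def f algebra_simps)
    finally show ?thesis .
  qed
  then show "\<exists>r>0. \<exists>a. \<forall>y\<in>I. \<bar>y - x\<bar> < r \<longrightarrow> (\<lambda>k. a k * (y - x) ^ k) sums f y"
    by (intro exI[of _ 1] conjI exI[of _ a]) auto
qed

lemma affine_absolutely_monotonic_on:
  assumes f: "\<And>x. x \<in> I \<Longrightarrow> f x = c + d * x"
    and nonneg: "c \<ge> 0" "d \<ge> 0" "I \<subseteq> {0..}"
  shows "absolutely_monotonic_on f I"
proof -
  define p where
    "p k x = (if k = 0 then c + d * x else if k = 1 then d else 0)" for k :: nat and x :: real
  have p_deriv: "(p k has_real_derivative p (Suc k) x) (at x)" for k x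
    by (cases "k = 0"; cases "k = 1") (auto simp: p_def [abs_def] intro!: derivative_eq_intros)
  have transfer: "((deriv ^^ k) f has_real_derivative p (Suc k) x) (at x)"
    if eq: "\<And>y. y \<in> interior I \<Longrightarrow> (deriv ^^ k) f y = p k y" and x: "x \<in> interior I" for k x
    by (rule has_field_derivative_transform_within_open[OF p_deriv open_interior x]) (simp add: eq)
  have eq: "(deriv ^^ k) f x = p k x" if "x \<in> interior I" for k x
    using that
  proof (induction k arbitrary: x)
    case 0
    then show ?case using interior_subset[of I] by (auto simp: p_def f)
  next
    case (Suc k)
    then show ?case using DERIV_imp_deriv[OF transfer[of k x]] by simp
  qed
  have "continuous_on I f"
    by (subst continuous_on_cong[OF refl f]) (auto intro!: continuous_intros)
  moreover have "(deriv ^^ k) f differentiable at x" if "x \<in> interior I" for k x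
    using transfer[OF eq that] by (auto simp: real_differentiable_def)
  moreover have "(deriv ^^ k) f x \<ge> 0" if "x \<in> interior I" for k x
    using that nonneg interior_subset[of I] by (auto simp: eq p_def)
  ultimately show ?thesis
    by (simp add: absolutely_monotonic_on_def)
qed

theorem theoremC:
  fixes G :: "nat \<Rightarrow> nat pair_pre_digraph"
    and R :: ereal
    and I :: "real set"
    and f :: "real \<Rightarrow> real"
  assumes graphs: "\<And>n. n \<ge> 1 \<Longrightarrow> labelled_graph (G n)"
    and unbounded_degree: "(SUP n \<in> {1..}. enat (max_degree (G n))) = \<infinity>"
    and R_pos: "0 < R"
    and I_def: "I = {x. 0 \<le> x \<and> ereal x < R}"
    and preserves:
      "\<And>n M \<beta>. \<lbrakk>n \<ge> 1; M \<in> graph_sym_mats (G n) I; \<beta> \<in> carrier_vec (graph_order (G n));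
          quad_form M \<beta> \<ge> 0\<rbrakk>
        \<Longrightarrow> quad_form (graph_entrywise f (G n) M) \<beta> \<ge> 0"
  shows "real_analytic_on f I \<and> absolutely_monotonic_on f I"
proof -
  have "enat 1 < (SUP n \<in> {1..}. enat (max_degree (G n)))"
    unfolding unbounded_degree by simp
  then obtain n where n: "n \<ge> 1" "max_degree (G n) \<ge> 2"
    unfolding less_SUP_iff by auto
  have G: "labelled_graph (G n)" using graphs n(1) by blast
  have pres: "preserves_form_nonneg (G n) f I"
    using preserves[OF n(1)] by (auto simp: preserves_form_nonneg_def)
  obtain u v w where arcs: "(u, v) \<in> parcs (G n)" "(u, w) \<in> parcs (G n)" "v \<noteq> w"
    using max_degree_ge_2_cherry[OF G n(2)] by blast
  have zero: "0 \<in> I" using R_pos by (simp add: I_def zero_ereal_def)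
  obtain r where r: "0 < r" "ereal r < R"
    using ereal_dense2[OF R_pos] by auto
  then have rI: "r \<in> I" by (simp add: I_def)
  define d where "d = (f r - f 0) / r"
  have affine: "f x = f 0 + d * x" if "x \<in> I" for x
  proof (cases "x = 0")
    case False
    then have "x > 0" using that by (simp add: I_def)
    from increment_proportional[OF G pres arcs zero rI that r(1) this]
    show ?thesis by (simp add: d_def mult.commute)
  qed simp
  have "f r \<ge> f 0"
    using increment_superhomogeneous[OF G pres arcs zero rI zero, of 0] r by simp
  then have "d \<ge> 0" "I \<subseteq> {0..}"
    using r by (auto simp: d_def I_def)
  with affine nonneg_at_zero[OF G pres arcs zero] show ?thesis
    by (blast intro: affine_real_analytic_on affine_absolutely_monotonic_on)
qed

end
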